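(* Let $G$ be a finite non-associative Moufang loop such that $[G,G,[G,G]]=1$, i.e. $[a,b,[c,d]]=1$ for all $a,b,c,d\in G$. Then the probability that three elements $x,y,z$ of $G$, chosen independently and uniformly at random, associate is at most $\frac{43}{64}$; that is, $$\frac{\left|\{(x,y,z)\in G^3 : (xy)z = x(yz)\}\right|}{|G|^3}\leq \frac{43}{64}.$$
   Context: A quasigroup is a set with a binary operation such that for all $a,b$ each of the equations $ax=b$ and $xa=b$ has a unique solution $x$. A loop is a quasigroup with a two-sided identity element $1$. A loop $G$ is a Moufang loop if it satisfies one of the following identities, which are equivalent for loops: $z(x(zy)) = ((zx)z)y$; $((xz)y)z = x(z(yz))$; $(zx)(yz) = (z(xy))z$ (for all $x,y,z \in G$). Non-associative means that $(xy)z\neq x(yz)$ for some $x,y,z\in G$. The associator $[a,b,c]$ of $a,b,c\in G$ is the unique element with $(ab)c=(a(bc))[a,b,c]$. The commutator $[a,b]$ is the unique element with $ab=(ba)[a,b]$. Elements $x,y,z$ associate if $(xy)z=x(yz)$, equivalently $[x,y,z]=1$. *)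

theory Defs
  imports Complex_Main "HOL-Algebra.Group"
begin

(* The record type of HOL-Algebra.Group serves only as a signature (carrier, multiplication,
   identity); none of the monoid axioms is assumed. *)

locale quasigroup =
  fixes G (structure)
  assumes m_closed: "\<lbrakk>a \<in> carrier G; b \<in> carrier G\<rbrakk> \<Longrightarrow> a \<otimes> b \<in> carrier G"
    and right_div: "\<lbrakk>a \<in> carrier G; b \<in> carrier G\<rbrakk> \<Longrightarrow> \<exists>!x. x \<in> carrier G \<and> a \<otimes> x = b"
    and left_div: "\<lbrakk>a \<in> carrier G; b \<in> carrier G\<rbrakk> \<Longrightarrow> \<exists>!x. x \<in> carrier G \<and> x \<otimes> a = b"

locale loop = quasigroup G for G (structure) +
  assumes one_closed: "\<one> \<in> carrier G"
    and l_one: "x \<in> carrier G \<Longrightarrow> \<one> \<otimes> x = x"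
    and r_one: "x \<in> carrier G \<Longrightarrow> x \<otimes> \<one> = x"

(* The three identities are equivalent for loops. *)
locale moufang_loop = loop G for G (structure) +
  assumes moufang:
    "(\<forall>x\<in>carrier G. \<forall>y\<in>carrier G. \<forall>z\<in>carrier G.
        z \<otimes> (x \<otimes> (z \<otimes> y)) = ((z \<otimes> x) \<otimes> z) \<otimes> y) \<or>
     (\<forall>x\<in>carrier G. \<forall>y\<in>carrier G. \<forall>z\<in>carrier G.
        ((x \<otimes> z) \<otimes> y) \<otimes> z = x \<otimes> (z \<otimes> (y \<otimes> z))) \<or>
     (\<forall>x\<in>carrier G. \<forall>y\<in>carrier G. \<forall>z\<in>carrier G.
        (z \<otimes> x) \<otimes> (y \<otimes> z) = (z \<otimes> (x \<otimes> y)) \<otimes> z)"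

definition associator :: "('a, 'b) monoid_scheme \<Rightarrow> 'a \<Rightarrow> 'a \<Rightarrow> 'a \<Rightarrow> 'a" where
  "associator G a b c =
     (THE u. u \<in> carrier G \<and>
        (a \<otimes>\<^bsub>G\<^esub> b) \<otimes>\<^bsub>G\<^esub> c = (a \<otimes>\<^bsub>G\<^esub> (b \<otimes>\<^bsub>G\<^esub> c)) \<otimes>\<^bsub>G\<^esub> u)"

definition commutator :: "('a, 'b) monoid_scheme \<Rightarrow> 'a \<Rightarrow> 'a \<Rightarrow> 'a" where
  "commutator G a b =
     (THE u. u \<in> carrier G \<and> a \<otimes>\<^bsub>G\<^esub> b = (b \<otimes>\<^bsub>G\<^esub> a) \<otimes>\<^bsub>G\<^esub> u)"

context quasigroup
begin

lemma associator_ex1: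
  assumes "a \<in> carrier G" "b \<in> carrier G" "c \<in> carrier G"
  shows "\<exists>!u. u \<in> carrier G \<and> (a \<otimes> b) \<otimes> c = (a \<otimes> (b \<otimes> c)) \<otimes> u"
  using right_div[of "a \<otimes> (b \<otimes> c)" "(a \<otimes> b) \<otimes> c"] assms
  by (simp add: m_closed eq_commute)

lemma commutator_ex1:
  assumes "a \<in> carrier G" "b \<in> carrier G"
  shows "\<exists>!u. u \<in> carrier G \<and> a \<otimes> b = (b \<otimes> a) \<otimes> u"
  using right_div[of "b \<otimes> a" "a \<otimes> b"] assms
  by (simp add: m_closed eq_commute)

end

end

theory Submission
  imports Defs
begin

text \<open>
  Write \<open>A x y z\<close> for \<open>(x y) z = x (y z)\<close>. In a Moufang loop \<open>A\<close> is invariant under permuting its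
  arguments. The map \<open>w \<mapsto> ((w x) y) (x y)\<^sup>-\<^sup>1\<close> is a pseudo-automorphism whose companion is the
  commutator \<open>[x, y]\<close>; when commutators are nuclear it is an automorphism, so its fixed points
  \<open>C = {w. A w x y}\<close> form a subloop. Hence each step of the chain
  \<open>N \<subset> N\<^sub>x \<subset> C \<subset> G\<close>, where \<open>N\<close> is the nucleus, \<open>x \<notin> N\<close>, \<open>N\<^sub>x = {y. \<forall>z. A x y z}\<close> and \<open>y \<notin> N\<^sub>x\<close>, at least
  doubles the cardinality, which yields a proportion of at least
  \<open>7/8 \<cdot> 3/4 \<cdot> 1/2 = 21/64\<close> of non-associating triples.
\<close>

section \<open>Cancellation laws in quasigroups and loops\<close>

context quasigroup
begin

declare m_closed [simp]

lemma l_cancel [simp]: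
  "\<lbrakk>a \<in> carrier G; x \<in> carrier G; y \<in> carrier G\<rbrakk> \<Longrightarrow> a \<otimes> x = a \<otimes> y \<longleftrightarrow> x = y"
  using right_div[of a "a \<otimes> x"] m_closed by metis

lemma r_cancel [simp]:
  "\<lbrakk>a \<in> carrier G; x \<in> carrier G; y \<in> carrier G\<rbrakk> \<Longrightarrow> x \<otimes> a = y \<otimes> a \<longleftrightarrow> x = y"
  using left_div[of a "x \<otimes> a"] m_closed by metis

end

declare (in loop) one_closed [simp] l_one [simp] r_one [simp]

section \<open>Loops with the inverse property\<close>

locale inverse_property_loop = loop G for G (structure) +
  assumes inverse_ex:
    "x \<in> carrier G \<Longrightarrow> \<exists>x'\<in>carrier G. \<forall>y\<in>carrier G. x' \<otimes> (x \<otimes> y) = y \<and> (y \<otimes> x) \<otimes> x' = y"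
begin

text \<open>\<open>m_inv\<close> is a definite description over two-sided inverses; cancelling
  \<open>x\<close> leaves the element from \<open>inverse_ex\<close> as the only candidate.\<close>

lemma inv_props:
  assumes "x \<in> carrier G"
  shows "inv x \<in> carrier G \<and>
    (\<forall>y\<in>carrier G. inv x \<otimes> (x \<otimes> y) = y \<and> (y \<otimes> x) \<otimes> inv x = y)"
proof -
  obtain x' where x': "x' \<in> carrier G"
    "\<And>y. y \<in> carrier G \<Longrightarrow> x' \<otimes> (x \<otimes> y) = y \<and> (y \<otimes> x) \<otimes> x' = y"
    using inverse_ex[OF assms] by blast
  have inverses: "x \<otimes> x' = \<one>" "x' \<otimes> x = \<one>"
    using x'(2)[of \<one>] assms by simp_all
  have "inv x = x'"
    unfolding m_inv_def
  proof (rule the_equality)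
    show "x' \<in> carrier G \<and> x \<otimes> x' = \<one> \<and> x' \<otimes> x = \<one>"
      using x'(1) inverses by simp
  next
    fix y assume "y \<in> carrier G \<and> x \<otimes> y = \<one> \<and> y \<otimes> x = \<one>"
    then show "y = x'"
      using inverses x'(1) assms l_cancel[of x y x'] by simp
  qed
  then show ?thesis using x' by simp
qed

lemma inv_closed [simp]: "x \<in> carrier G \<Longrightarrow> inv x \<in> carrier G"
  using inv_props by blast

lemma inv_mult_cancel_left [simp]:
  "\<lbrakk>x \<in> carrier G; y \<in> carrier G\<rbrakk> \<Longrightarrow> inv x \<otimes> (x \<otimes> y) = y"
  using inv_props by blast

lemma mult_inv_cancel_right [simp]:
  "\<lbrakk>x \<in> carrier G; y \<in> carrier G\<rbrakk> \<Longrightarrow> (y \<otimes> x) \<otimes> inv x = y"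
  using inv_props by blast

lemma l_inv [simp]: "x \<in> carrier G \<Longrightarrow> inv x \<otimes> x = \<one>"
  using inv_mult_cancel_left[of x \<one>] by simp

lemma r_inv [simp]: "x \<in> carrier G \<Longrightarrow> x \<otimes> inv x = \<one>"
  using mult_inv_cancel_right[of x \<one>] by simp

lemma inv_inv [simp]: "x \<in> carrier G \<Longrightarrow> inv (inv x) = x"
  using inv_mult_cancel_left[of "inv x" x] by simp

lemma mult_inv_cancel_left [simp]:
  "\<lbrakk>x \<in> carrier G; y \<in> carrier G\<rbrakk> \<Longrightarrow> x \<otimes> (inv x \<otimes> y) = y"
  using inv_mult_cancel_left[of "inv x" y] by simp

lemma inv_mult_cancel_right [simp]:
  "\<lbrakk>x \<in> carrier G; y \<in> carrier G\<rbrakk> \<Longrightarrow> (y \<otimes> inv x) \<otimes> x = y"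
  using mult_inv_cancel_right[of "inv x" y] by simp

lemma eq_mult_inv_iff:
  "\<lbrakk>a \<in> carrier G; b \<in> carrier G; c \<in> carrier G\<rbrakk> \<Longrightarrow> a = c \<otimes> inv b \<longleftrightarrow> a \<otimes> b = c"
  by auto

lemma eq_inv_mult_iff:
  "\<lbrakk>a \<in> carrier G; b \<in> carrier G; c \<in> carrier G\<rbrakk> \<Longrightarrow> b = inv a \<otimes> c \<longleftrightarrow> a \<otimes> b = c"
  by auto

lemma inv_mult:
  assumes "x \<in> carrier G" "y \<in> carrier G"
  shows "inv (x \<otimes> y) = inv y \<otimes> inv x"
proof -
  \<comment> \<open>Start from \<open>inv x \<otimes> (x \<otimes> y) = y\<close> and multiply on
    the right by \<open>inv (x \<otimes> y)\<close>; the inverse property replaces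
    associativity.\<close>
  have "y \<otimes> inv (x \<otimes> y) = inv x"
    using assms inv_mult_cancel_left[of x y] mult_inv_cancel_right[of "x \<otimes> y" "inv x"] by simp
  then show ?thesis
    using assms by (simp add: eq_inv_mult_iff)
qed

section \<open>The middle Moufang identity from the left or the right one\<close>

lemma middle_from_left_moufang:
  assumes L: "\<And>x y z. \<lbrakk>x \<in> carrier G; y \<in> carrier G; z \<in> carrier G\<rbrakk> \<Longrightarrow>
      z \<otimes> (x \<otimes> (z \<otimes> y)) = ((z \<otimes> x) \<otimes> z) \<otimes> y"
    and G: "x \<in> carrier G" "y \<in> carrier G" "z \<in> carrier G"
  shows "(z \<otimes> x) \<otimes> (y \<otimes> z) = (z \<otimes> (x \<otimes> y)) \<otimes> z"
  \<comment> \<open>This instance collapses on the left to \<open>z \<otimes> x\<close>; its last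
    factor is \<open>inv (y \<otimes> z)\<close>, which then moves across.\<close>
  using L[of "x \<otimes> y" "inv z \<otimes> inv y" z] G
    eq_mult_inv_iff[of "(z \<otimes> (x \<otimes> y)) \<otimes> z" "inv z \<otimes> inv y" "z \<otimes> x"]
  by (simp add: inv_mult)

lemma middle_from_right_moufang:
  assumes R: "\<And>x y z. \<lbrakk>x \<in> carrier G; y \<in> carrier G; z \<in> carrier G\<rbrakk> \<Longrightarrow>
      ((x \<otimes> z) \<otimes> y) \<otimes> z = x \<otimes> (z \<otimes> (y \<otimes> z))"
    and G: "x \<in> carrier G" "y \<in> carrier G" "z \<in> carrier G"
  shows "(z \<otimes> x) \<otimes> (y \<otimes> z) = (z \<otimes> (x \<otimes> y)) \<otimes> z"
proof -
  \<comment> \<open>The mirror choice: the left side of this instance of \<open>R\<close> collapses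
    to \<open>y \<otimes> z\<close>, and the leading factor \<open>inv x \<otimes> inv z\<close> is
    \<open>inv (z \<otimes> x)\<close>. Putting \<one> in the first slot of \<open>R\<close> then
    gives flexibility.\<close>
  have "(z \<otimes> x) \<otimes> (y \<otimes> z) = z \<otimes> ((x \<otimes> y) \<otimes> z)"
    using R[of "inv x \<otimes> inv z" "x \<otimes> y" z] G
      eq_inv_mult_iff[of "inv x \<otimes> inv z" "z \<otimes> ((x \<otimes> y) \<otimes> z)" "y \<otimes> z"]
    by (simp add: inv_mult)
  also have "\<dots> = (z \<otimes> (x \<otimes> y)) \<otimes> z"
    using R[of \<one> "x \<otimes> y" z] G by simp
  finally show ?thesis .
qed

end

section \<open>The inverse property from each single Moufang identity\<close>

context loop
begin

lemma inverse_from_left_moufang: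
  assumes L: "\<And>x y z. \<lbrakk>x \<in> carrier G; y \<in> carrier G; z \<in> carrier G\<rbrakk> \<Longrightarrow>
      z \<otimes> (x \<otimes> (z \<otimes> y)) = ((z \<otimes> x) \<otimes> z) \<otimes> y"
    and z: "z \<in> carrier G"
  shows "\<exists>z'\<in>carrier G. \<forall>y\<in>carrier G. z' \<otimes> (z \<otimes> y) = y \<and> (y \<otimes> z) \<otimes> z' = y"
proof -
  obtain r where r: "r \<in> carrier G" "z \<otimes> r = \<one>"
    using right_div[OF z one_closed] by blast
  have left: "r \<otimes> (z \<otimes> y) = y" if "y \<in> carrier G" for y
    using L[of r y z] r z that l_cancel[of z "r \<otimes> (z \<otimes> y)" y] by simp
  \<comment> \<open>Only elements of the form \<open>z \<otimes> x\<close> are reached by the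
    identity, but by divisibility every \<open>y\<close> has this form.\<close>
  have right: "(y \<otimes> z) \<otimes> r = y" if y: "y \<in> carrier G" for y
  proof -
    obtain x where "x \<in> carrier G" "z \<otimes> x = y"
      using right_div[OF z y] by blast
    then show ?thesis using L[of x r z] r z by simp
  qed
  show ?thesis using r left right by blast
qed

lemma inverse_from_right_moufang:
  assumes R: "\<And>x y z. \<lbrakk>x \<in> carrier G; y \<in> carrier G; z \<in> carrier G\<rbrakk> \<Longrightarrow>
      ((x \<otimes> z) \<otimes> y) \<otimes> z = x \<otimes> (z \<otimes> (y \<otimes> z))"
    and z: "z \<in> carrier G"
  shows "\<exists>z'\<in>carrier G. \<forall>y\<in>carrier G. z' \<otimes> (z \<otimes> y) = y \<and> (y \<otimes> z) \<otimes> z' = y"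
proof -
  obtain l where l: "l \<in> carrier G" "l \<otimes> z = \<one>"
    using left_div[OF z one_closed] by blast
  have right: "(y \<otimes> z) \<otimes> l = y" if "y \<in> carrier G" for y
    using R[of y l z] l z that r_cancel[of z "(y \<otimes> z) \<otimes> l" y] by simp
  have left: "l \<otimes> (z \<otimes> y) = y" if y: "y \<in> carrier G" for y
  proof -
    obtain x where "x \<in> carrier G" "x \<otimes> z = y"
      using left_div[OF z y] by blast
    then show ?thesis using R[of l x z] l z by simp
  qed
  show ?thesis using l left right by blast
qed

lemma inverse_from_middle_moufang:
  assumes M: "\<And>x y z. \<lbrakk>x \<in> carrier G; y \<in> carrier G; z \<in> carrier G\<rbrakk> \<Longrightarrow>
      (z \<otimes> x) \<otimes> (y \<otimes> z) = (z \<otimes> (x \<otimes> y)) \<otimes> z"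
    and z: "z \<in> carrier G"
  shows "\<exists>z'\<in>carrier G. \<forall>y\<in>carrier G. z' \<otimes> (z \<otimes> y) = y \<and> (y \<otimes> z) \<otimes> z' = y"
proof -
  have right_inverse: "w \<otimes> (r \<otimes> y) = y"
    if "w \<in> carrier G" "r \<in> carrier G" "w \<otimes> r = \<one>" "y \<in> carrier G" for w r y
    using M[of r y w] that r_cancel[of w y "w \<otimes> (r \<otimes> y)"] by simp
  have flexible: "w \<otimes> (y \<otimes> w) = (w \<otimes> y) \<otimes> w" if "w \<in> carrier G" "y \<in> carrier G" for w y
    using M[of \<one> y w] that by simp
  have left_inverse: "(y \<otimes> l) \<otimes> w = y"
    if "w \<in> carrier G" "l \<in> carrier G" "l \<otimes> w = \<one>" "y \<in> carrier G" for w l y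
    using M[of y l w] that flexible[of w "y \<otimes> l"] l_cancel[of w y "(y \<otimes> l) \<otimes> w"]
    by simp
  obtain r where r: "r \<in> carrier G" "z \<otimes> r = \<one>"
    using right_div[OF z one_closed] by blast
  \<comment> \<open>The two auxiliary facts need only a one-sided inverse. Once \<open>r\<close> is
    two-sided, \<open>right_inverse\<close> also applies with \<open>z\<close> and \<open>r\<close>
    exchanged.\<close>
  have rz: "r \<otimes> z = \<one>"
    using right_inverse[OF z r(1,2) z] l_cancel[of z "r \<otimes> z" \<one>] r z
    by simp
  show ?thesis
    using r rz z right_inverse[of r z] left_inverse[of r z] by blast
qed

end

section \<open>The identities available in every Moufang loop\<close>

context moufang_loop
begin

lemma moufang_inverse:
  "z \<in> carrier G \<Longrightarrow> \<exists>z'\<in>carrier G. \<forall>y\<in>carrier G. z' \<otimes> (z \<otimes> y) = y \<and> (y \<otimes> z) \<otimes> z' = y"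
  using moufang
  by (elim disjE)
    (simp_all add: inverse_from_left_moufang inverse_from_right_moufang inverse_from_middle_moufang)

end

sublocale moufang_loop \<subseteq> inverse_property_loop
  by unfold_locales (rule moufang_inverse)

context moufang_loop
begin

lemma middle_moufang:
  assumes "x \<in> carrier G" "y \<in> carrier G" "z \<in> carrier G"
  shows "(z \<otimes> x) \<otimes> (y \<otimes> z) = (z \<otimes> (x \<otimes> y)) \<otimes> z"
  using moufang assms
  by (elim disjE) (simp_all add: middle_from_left_moufang middle_from_right_moufang)

lemma flexible:
  "\<lbrakk>x \<in> carrier G; z \<in> carrier G\<rbrakk> \<Longrightarrow> (z \<otimes> x) \<otimes> z = z \<otimes> (x \<otimes> z)"
  using middle_moufang[of \<one> x z] by simp

lemma right_moufang:
  assumes "x \<in> carrier G" "y \<in> carrier G" "z \<in> carrier G"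
  shows "((x \<otimes> z) \<otimes> y) \<otimes> z = x \<otimes> (z \<otimes> (y \<otimes> z))"
proof -
  \<comment> \<open>Since \<open>inv z \<otimes> inv x\<close> is
    \<open>inv (x \<otimes> z)\<close>, this instance of the middle identity cancels on both
    sides.\<close>
  have "inv x \<otimes> (((x \<otimes> z) \<otimes> y) \<otimes> z) = z \<otimes> (y \<otimes> z)"
    using middle_moufang[of "inv z \<otimes> inv x" "(x \<otimes> z) \<otimes> y" z] assms
      inv_mult_cancel_left[of "x \<otimes> z" y] flexible[of y z]
    by (simp add: inv_mult)
  then show ?thesis
    using assms eq_inv_mult_iff[of "inv x" "((x \<otimes> z) \<otimes> y) \<otimes> z" "z \<otimes> (y \<otimes> z)"] by auto
qed

section \<open>Invariance of associativity under permuting the three elements\<close>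

definition associate :: "'a \<Rightarrow> 'a \<Rightarrow> 'a \<Rightarrow> bool" where
  "associate x y z \<longleftrightarrow> (x \<otimes> y) \<otimes> z = x \<otimes> (y \<otimes> z)"

lemma associate_mult_inv:
  "\<lbrakk>x \<in> carrier G; y \<in> carrier G; z \<in> carrier G\<rbrakk> \<Longrightarrow>
    associate x (y \<otimes> z) (inv z) \<longleftrightarrow> associate x y z"
  unfolding associate_def using eq_mult_inv_iff[of "x \<otimes> y" z "x \<otimes> (y \<otimes> z)"] by auto

text \<open>Right Moufang and flexibility rewrite
  \<open>x \<otimes> ((z \<otimes> y) \<otimes> z)\<close> as
  \<open>((x \<otimes> z) \<otimes> y) \<otimes> z\<close>, and the outer \<open>z\<close>
  cancels.\<close>

lemma associate_mult_middle:
  assumes "x \<in> carrier G" "y \<in> carrier G" "z \<in> carrier G"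
  shows "associate x (z \<otimes> y) z \<longleftrightarrow> associate x z y"
proof -
  have "associate x (z \<otimes> y) z \<longleftrightarrow> (x \<otimes> (z \<otimes> y)) \<otimes> z = ((x \<otimes> z) \<otimes> y) \<otimes> z"
    unfolding associate_def using right_moufang[of x y z] flexible[of y z] assms by simp
  then show ?thesis
    unfolding associate_def using assms by auto
qed

text \<open>Both sides are equivalent to \<open>associate x z (inv z \<otimes> w)\<close>, by the
  two preceding lemmas and \<open>z \<otimes> (inv z \<otimes> w) = w\<close>.\<close>

lemma associate_inv_mult:
  assumes "x \<in> carrier G" "w \<in> carrier G" "z \<in> carrier G"
  shows "associate x w (inv w \<otimes> z) \<longleftrightarrow> associate x w z"
  using associate_mult_inv[of x z "inv z \<otimes> w"] associate_mult_middle[of x "inv z \<otimes> w" z] assms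
  by (simp add: inv_mult)

text \<open>\<open>associate_inv_mult\<close> replaces the last entry on each side, leaving
  \<open>associate x y (inv y \<otimes> z)\<close> against
  \<open>associate x z (inv z \<otimes> y)\<close>; these agree by
  \<open>associate_mult_inv\<close>.\<close>

lemma associate_swap_right:
  assumes "x \<in> carrier G" "y \<in> carrier G" "z \<in> carrier G"
  shows "associate x y z \<longleftrightarrow> associate x z y"
  using associate_mult_inv[of x y "inv y \<otimes> z"] associate_inv_mult[of x y z]
    associate_inv_mult[of x z y] assms
  by (simp add: inv_mult)

lemma associate_reverse:
  assumes "x \<in> carrier G" "y \<in> carrier G" "z \<in> carrier G"
  shows "associate (inv z) (inv y) (inv x) \<longleftrightarrow> associate x y z"
proof -
  have "associate (inv z) (inv y) (inv x) \<longleftrightarrow> inv (x \<otimes> (y \<otimes> z)) = inv ((x \<otimes> y) \<otimes> z)"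
    unfolding associate_def using assms by (simp add: inv_mult)
  also have "\<dots> \<longleftrightarrow> associate x y z"
    unfolding associate_def using assms inv_inv m_closed by metis
  finally show ?thesis .
qed

text \<open>Inversion reverses products, so it turns a swap of the last two entries into a swap of
  the first two.\<close>

lemma associate_swap_left:
  assumes "x \<in> carrier G" "y \<in> carrier G" "z \<in> carrier G"
  shows "associate x y z \<longleftrightarrow> associate y x z"
  using associate_reverse[of x y z] associate_reverse[of y x z]
    associate_swap_right[of "inv z" "inv x" "inv y"] assms
  by simp

lemma associate_rotate:
  assumes "x \<in> carrier G" "y \<in> carrier G" "z \<in> carrier G"
  shows "associate x y z \<longleftrightarrow> associate z x y"
  using associate_swap_right[of x y z] associate_swap_left[of x z y] assms by simp

text \<open>Flexibility, carried to the other positions by symmetry, becomes the two alternative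
  laws.\<close>

lemma associate_same:
  assumes "x \<in> carrier G" "y \<in> carrier G"
  shows "associate x x y" "associate x y y"
proof -
  have "associate x y x" "associate y x y"
    using flexible assms by (simp_all add: associate_def)
  then show "associate x x y" "associate x y y"
    using associate_swap_right[of x x y] associate_swap_left[of x y y] assms by simp_all
qed

section \<open>Right inner mappings and their multiplicativity\<close>

lemma mult_right_autotopism:
  assumes "p \<in> carrier G" "q \<in> carrier G" "z \<in> carrier G"
  shows "(p \<otimes> q) \<otimes> z = (p \<otimes> inv z) \<otimes> (z \<otimes> (q \<otimes> z))"
  \<comment> \<open>Right Moufang read as an autotopism: right translation by \<open>z\<close> acts
    on a product through separate maps of the two factors, so such rules can be composed.\<close>
  using right_moufang[of "p \<otimes> inv z" q z] assms by simp

lemma commutator_eq: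
  assumes "x \<in> carrier G" "y \<in> carrier G"
  shows "commutator G x y = (inv x \<otimes> inv y) \<otimes> (x \<otimes> y)"
  unfolding commutator_def
proof (rule the1_equality[OF commutator_ex1[OF assms]])
  show "(inv x \<otimes> inv y) \<otimes> (x \<otimes> y) \<in> carrier G \<and>
      x \<otimes> y = y \<otimes> x \<otimes> ((inv x \<otimes> inv y) \<otimes> (x \<otimes> y))"
    using assms mult_inv_cancel_left[of "y \<otimes> x" "x \<otimes> y"] by (simp add: inv_mult)
qed

lemma associate_if_associator_one:
  assumes "a \<in> carrier G" "b \<in> carrier G" "c \<in> carrier G" "associator G a b c = \<one>"
  shows "associate a b c"
  using theI'[OF associator_ex1[OF assms(1-3)]] assms
  by (simp add: associator_def associate_def)

definition right_inner :: "'a \<Rightarrow> 'a \<Rightarrow> 'a \<Rightarrow> 'a" where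
  "right_inner x y w = ((w \<otimes> x) \<otimes> y) \<otimes> inv (x \<otimes> y)"

lemma right_inner_closed:
  "\<lbrakk>x \<in> carrier G; y \<in> carrier G; w \<in> carrier G\<rbrakk> \<Longrightarrow> right_inner x y w \<in> carrier G"
  by (simp add: right_inner_def)

lemma right_inner_fixes_iff:
  assumes "x \<in> carrier G" "y \<in> carrier G" "w \<in> carrier G"
  shows "right_inner x y w = w \<longleftrightarrow> associate w x y"
  unfolding right_inner_def associate_def
  using eq_mult_inv_iff[of w "x \<otimes> y" "(w \<otimes> x) \<otimes> y"] assms by (auto simp: eq_commute)

lemma right_inner_mult:
  assumes x: "x \<in> carrier G" and y: "y \<in> carrier G"
    and nuclear: "\<And>a b. \<lbrakk>a \<in> carrier G; b \<in> carrier G\<rbrakk> \<Longrightarrow> associate a b (commutator G x y)"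
    and u: "u \<in> carrier G" and v: "v \<in> carrier G"
  shows "right_inner x y (u \<otimes> v) = right_inner x y u \<otimes> right_inner x y v"
proof -
  let ?\<phi> = "right_inner x y" and ?z = "inv (x \<otimes> y)"
  \<comment> \<open>\<alpha> and \<beta> are the factor maps obtained by composing the autotopisms
    for right translation by \<open>x\<close>, then \<open>y\<close>, then
    \<open>inv (x \<otimes> y)\<close>.\<close>
  define \<alpha> where "\<alpha> a = ((a \<otimes> inv x) \<otimes> inv y) \<otimes> (x \<otimes> y)" for a
  define \<beta> where "\<beta> b = ?z \<otimes> ((y \<otimes> ((x \<otimes> (b \<otimes> x)) \<otimes> y)) \<otimes> ?z)" for b
  define n where "n = commutator G x y"
  have \<alpha>_closed: "\<alpha> a \<in> carrier G" and \<beta>_closed: "\<beta> a \<in> carrier G" if "a \<in> carrier G" for a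
    using that x y by (simp_all add: \<alpha>_def \<beta>_def)
  have autotopism: "?\<phi> (a \<otimes> b) = \<alpha> a \<otimes> \<beta> b" if "a \<in> carrier G" "b \<in> carrier G" for a b
    unfolding right_inner_def \<alpha>_def \<beta>_def using that x y
    by (simp add: mult_right_autotopism[of a b x]
        mult_right_autotopism[of "a \<otimes> inv x" "x \<otimes> (b \<otimes> x)" y]
        mult_right_autotopism[of "(a \<otimes> inv x) \<otimes> inv y" "y \<otimes> ((x \<otimes> (b \<otimes> x)) \<otimes> y)" ?z])
  have n: "n \<in> carrier G" "\<alpha> \<one> = n"
    using x y by (simp_all add: n_def \<alpha>_def commutator_eq)
  have "\<one> = n \<otimes> \<beta> \<one>"
    using autotopism[of \<one> \<one>] x y n by (simp add: right_inner_def)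
  then have \<beta>_one: "\<beta> \<one> = inv n"
    using n \<beta>_closed[of \<one>] eq_inv_mult_iff[of n "\<beta> \<one>" \<one>] by simp
  have \<phi>_closed: "?\<phi> a \<in> carrier G" if "a \<in> carrier G" for a
    using right_inner_closed x y that by blast
  \<comment> \<open>Setting one argument of the autotopism to \<one> expresses each factor map
    through \<open>right_inner x y\<close> and the companion \<open>n\<close>.\<close>
  have \<alpha>: "\<alpha> u = ?\<phi> u \<otimes> n"
    using autotopism[of u \<one>] u n \<alpha>_closed[OF u] by (simp add: \<beta>_one)
  have \<beta>: "\<beta> v = inv n \<otimes> ?\<phi> v"
    using autotopism[of \<one> v] v n \<beta>_closed[OF v] by simp
  \<comment> \<open>The hypothesis has the commutator in the last slot; symmetry moves it to the
    middle, where \<open>n\<close> cancels against \<open>inv n\<close>.\<close>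
  have "associate (?\<phi> u) n (inv n \<otimes> ?\<phi> v)"
    using nuclear[of "?\<phi> u" "inv n \<otimes> ?\<phi> v"] \<phi>_closed u v n
      associate_swap_right[of "?\<phi> u" n "inv n \<otimes> ?\<phi> v"] by (simp add: n_def)
  then show ?thesis
    using autotopism[OF u v] \<phi>_closed u v n by (simp add: \<alpha> \<beta> associate_def)
qed

end

section \<open>Two counting tools\<close>

lemma card_le_half_if_translate:
  fixes G (structure)
  assumes "quasigroup G" "finite K" "K \<subseteq> carrier G" "H \<subseteq> K" "k \<in> carrier G"
    and translate: "\<And>h. h \<in> H \<Longrightarrow> k \<otimes> h \<in> K - H"
  shows "2 * card H \<le> card K"
proof -
  interpret quasigroup G by fact
  have "H \<subseteq> carrier G" using assms by blast
  \<comment> \<open>Left translation by \<open>k\<close> embeds \<open>H\<close> into its complement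
    in \<open>K\<close>, so that complement is at least as large as \<open>H\<close>.\<close>
  then have "inj_on (\<lambda>h. k \<otimes> h) H"
    using assms(5) by (auto intro!: inj_onI simp: subset_iff)
  then have "card H \<le> card (K - H)"
    by (metis card_inj_on_le assms(2) finite_Diff image_subsetI translate)
  moreover have "card H + card (K - H) = card K"
    using assms(2,4) by (metis card_Diff_subset card_mono finite_subset le_add_diff_inverse)
  ultimately show ?thesis by simp
qed

lemma sum_bound_two_values:
  fixes f :: "'a \<Rightarrow> real" and b c :: real
  assumes "finite A" "B \<subseteq> A" "\<And>x. x \<in> B \<Longrightarrow> f x \<le> b" "\<And>x. x \<in> A - B \<Longrightarrow> f x \<le> c"
  shows "sum f A \<le> card B * b + (real (card A) - card B) * c"
proof -
  have "sum f A = sum f B + sum f (A - B)"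
    using assms sum.subset_diff[of B A f] by simp
  also have "\<dots> \<le> card B * b + card (A - B) * c"
    by (intro add_mono sum_bounded_above) (use assms in auto)
  also have "real (card (A - B)) = real (card A) - card B"
    using assms by (simp add: card_Diff_subset card_mono finite_subset of_nat_diff)
  finally show ?thesis .
qed

section \<open>The chain of subloops and its cardinalities\<close>

locale nuclear_commutator_moufang_loop = moufang_loop G for G (structure) +
  assumes finite_carrier: "finite (carrier G)"
    and commutator_nuclear: "\<lbrakk>a \<in> carrier G; b \<in> carrier G; c \<in> carrier G; d \<in> carrier G\<rbrakk> \<Longrightarrow>
      associator G a b (commutator G c d) = \<one>"
begin

text \<open>\<open>h\<close> is a fixed point of the multiplicative map
  \<open>right_inner x y\<close>, so \<open>k \<otimes> h\<close> is fixed exactly when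
  \<open>k\<close> is. The equivalence gives closure and also keeps translates by an outside element
  outside.\<close>

lemma associate_mult_iff:
  assumes G: "x \<in> carrier G" "y \<in> carrier G" "k \<in> carrier G" "h \<in> carrier G"
    and h: "associate x y h"
  shows "associate x y (k \<otimes> h) \<longleftrightarrow> associate x y k"
proof -
  have "associate a b (commutator G x y)" if "a \<in> carrier G" "b \<in> carrier G" for a b
    using that G commutator_nuclear associate_if_associator_one by (simp add: commutator_eq)
  then have "right_inner x y (k \<otimes> h) = right_inner x y k \<otimes> right_inner x y h"
    using right_inner_mult G by blast
  moreover have "right_inner x y h = h"
    using h G associate_rotate[of x y h] right_inner_fixes_iff by simp
  ultimately have "right_inner x y (k \<otimes> h) = k \<otimes> h \<longleftrightarrow> right_inner x y k = k"
    using G right_inner_closed by simp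
  then show ?thesis
    using G associate_rotate[of x y] right_inner_fixes_iff by simp
qed

definition associating :: "'a \<Rightarrow> 'a \<Rightarrow> 'a set" where
  "associating x y = {z \<in> carrier G. associate x y z}"

definition partial_nucleus :: "'a \<Rightarrow> 'a set" where
  "partial_nucleus x = {y \<in> carrier G. \<forall>z\<in>carrier G. associate x y z}"

text \<open>One slot suffices: by symmetry of \<open>associate\<close>, the left, middle and right
  nuclei coincide.\<close>

definition nucleus :: "'a set" where
  "nucleus = {x \<in> carrier G. \<forall>y\<in>carrier G. \<forall>z\<in>carrier G. associate x y z}"

lemma subset_carrier:
  "associating x y \<subseteq> carrier G" "partial_nucleus x \<subseteq> carrier G" "nucleus \<subseteq> carrier G"
  by (auto simp: associating_def partial_nucleus_def nucleus_def)

lemma finite_associating: "finite (associating x y)"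
  and finite_partial_nucleus: "finite (partial_nucleus x)"
  using finite_carrier by (simp_all add: associating_def partial_nucleus_def)

lemma partial_nucleus_mult_iff:
  assumes "x \<in> carrier G" "k \<in> carrier G" "h \<in> partial_nucleus x"
  shows "k \<otimes> h \<in> partial_nucleus x \<longleftrightarrow> k \<in> partial_nucleus x"
proof -
  have h: "h \<in> carrier G" "\<And>z. z \<in> carrier G \<Longrightarrow> associate x z h"
    using assms associate_swap_right by (auto simp: partial_nucleus_def)
  have "associate x (k \<otimes> h) z \<longleftrightarrow> associate x k z" if "z \<in> carrier G" for z
    using associate_mult_iff[of x z k h] associate_swap_right[of x z] h assms that by simp
  then show ?thesis
    using assms h by (simp add: partial_nucleus_def)
qed

lemma nucleus_mult_iff:
  assumes "k \<in> carrier G" "h \<in> nucleus"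
  shows "k \<otimes> h \<in> nucleus \<longleftrightarrow> k \<in> nucleus"
proof -
  have h: "h \<in> carrier G" "\<And>y z. \<lbrakk>y \<in> carrier G; z \<in> carrier G\<rbrakk> \<Longrightarrow> associate y z h"
    using assms associate_rotate by (auto simp: nucleus_def)
  have "associate (k \<otimes> h) y z \<longleftrightarrow> associate k y z" if "y \<in> carrier G" "z \<in> carrier G" for y z
    using associate_mult_iff[of y z k h] associate_rotate[of y z] h assms that by simp
  then show ?thesis
    using assms h by (simp add: nucleus_def)
qed

lemma card_associating:
  assumes "x \<in> carrier G" "y \<in> carrier G" "y \<notin> partial_nucleus x"
  shows "2 * card (associating x y) \<le> card (carrier G)"
proof -
  obtain k where k: "k \<in> carrier G" "\<not> associate x y k"
    using assms by (auto simp: partial_nucleus_def)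
  show ?thesis
  proof (rule card_le_half_if_translate[OF quasigroup_axioms finite_carrier subset_refl _ k(1)])
    show "k \<otimes> h \<in> carrier G - associating x y" if "h \<in> associating x y" for h
      using that k assms associate_mult_iff[of x y k h] by (auto simp: associating_def)
  qed (rule subset_carrier)
qed

text \<open>The translating element is \<open>y\<close> itself: it lies in
  \<open>associating x y\<close> by the alternative law, but outside
  \<open>partial_nucleus x\<close>.\<close>

lemma card_partial_nucleus:
  assumes "x \<in> carrier G" "y \<in> carrier G" "y \<notin> partial_nucleus x"
  shows "2 * card (partial_nucleus x) \<le> card (associating x y)"
proof (rule card_le_half_if_translate[OF quasigroup_axioms _ _ _ assms(2)])
  show sub: "partial_nucleus x \<subseteq> associating x y"
    using associate_swap_right assms by (auto simp: associating_def partial_nucleus_def)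
  show "y \<otimes> h \<in> associating x y - partial_nucleus x" if "h \<in> partial_nucleus x" for h
    using that sub assms partial_nucleus_mult_iff associate_mult_iff[of x y y h] associate_same
    by (auto simp: associating_def)
qed (simp_all add: finite_associating subset_carrier)

text \<open>Here \<open>x\<close> translates: it lies in its own partial nucleus by the alternative
  law, but not in the nucleus.\<close>

lemma card_nucleus:
  assumes "x \<in> carrier G" "x \<notin> nucleus"
  shows "2 * card nucleus \<le> card (partial_nucleus x)"
proof (rule card_le_half_if_translate[OF quasigroup_axioms _ _ _ assms(1)])
  show sub: "nucleus \<subseteq> partial_nucleus x"
    using associate_swap_left assms by (auto simp: nucleus_def partial_nucleus_def)
  have "x \<in> partial_nucleus x"
    using assms associate_same by (simp add: partial_nucleus_def)
  then show "x \<otimes> h \<in> partial_nucleus x - nucleus" if "h \<in> nucleus" for h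
    using that sub assms partial_nucleus_mult_iff[of x x h] nucleus_mult_iff[of x h] by auto
qed (simp_all add: finite_partial_nucleus subset_carrier)

section \<open>Counting associating pairs and triples\<close>

lemma sum_card_associating:
  assumes x: "x \<in> carrier G" "x \<notin> nucleus"
  shows "8 * (\<Sum>y\<in>carrier G. real (card (associating x y))) \<le> 5 * real (card (carrier G)) ^ 2"
    and "8 * card nucleus \<le> card (carrier G)"
proof -
  let ?n = "real (card (carrier G))" and ?m = "real (card (partial_nucleus x))"
  obtain y where "y \<in> carrier G" "y \<notin> partial_nucleus x"
    using x by (auto simp: nucleus_def partial_nucleus_def)
  then have m: "4 * card (partial_nucleus x) \<le> card (carrier G)"
    using card_partial_nucleus card_associating x by fastforce
  then show "8 * card nucleus \<le> card (carrier G)"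
    using card_nucleus[OF x] by simp
  \<comment> \<open>The bound equals \<open>(?n ^ 2 + ?m * ?n) / 2\<close>; with \<open>?m\<close>
    at most \<open>?n / 4\<close> this is at most 5/8 of \<open>?n ^ 2\<close>.\<close>
  have "(\<Sum>y\<in>carrier G. real (card (associating x y))) \<le> ?m * ?n + (?n - ?m) * (?n / 2)"
  proof (rule sum_bound_two_values[OF finite_carrier subset_carrier(2)])
    show "real (card (associating x y)) \<le> ?n" for y
      using card_mono[OF finite_carrier subset_carrier(1)] by simp
    show "real (card (associating x y)) \<le> ?n / 2" if "y \<in> carrier G - partial_nucleus x" for y
      using card_associating[OF x(1), of y] that by simp
  qed
  moreover have "4 * ?m * ?n \<le> ?n * ?n"
    using m by (intro mult_right_mono) simp_all
  ultimately show "8 * (\<Sum>y\<in>carrier G. real (card (associating x y))) \<le> 5 * ?n ^ 2"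
    by (simp add: algebra_simps power2_eq_square)
qed

lemma card_associating_triples:
  assumes "x \<in> carrier G" "x \<notin> nucleus"
  shows "64 * real (card (SIGMA x:carrier G. SIGMA y:carrier G. associating x y))
      \<le> 43 * real (card (carrier G)) ^ 3"
proof -
  let ?n = "real (card (carrier G))" and ?m = "real (card nucleus)"
  let ?s = "\<lambda>x. \<Sum>y\<in>carrier G. real (card (associating x y))"
  have "real (card (SIGMA x:carrier G. SIGMA y:carrier G. associating x y)) = sum ?s (carrier G)"
    using finite_carrier finite_associating by (simp add: card_SigmaI)
  \<comment> \<open>Nuclear \<open>x\<close> contribute at most \<open>?n ^ 2\<close> each, all
    others at most 5/8 of that. As the nucleus has at most 1/8 of the elements, the total proportion
    is at most 5/8 + 3/8 * 1/8 = 43/64.\<close>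
  also have "\<dots> \<le> ?m * ?n ^ 2 + (?n - ?m) * (5 / 8 * ?n ^ 2)"
  proof (rule sum_bound_two_values[OF finite_carrier subset_carrier(3)])
    have "real (card (associating x y)) \<le> ?n" for x y
      using card_mono[OF finite_carrier subset_carrier(1)] by simp
    then show "?s x \<le> ?n ^ 2" for x
      using sum_bounded_above[of "carrier G" "\<lambda>y. real (card (associating x y))" ?n]
      by (simp add: power2_eq_square)
    show "?s x \<le> 5 / 8 * ?n ^ 2" if "x \<in> carrier G - nucleus" for x
      using sum_card_associating(1)[of x] that by simp
  qed
  finally have "64 * real (card (SIGMA x:carrier G. SIGMA y:carrier G. associating x y))
      \<le> 24 * ?m * ?n ^ 2 + 40 * ?n ^ 3"
    by (simp add: field_simps power2_eq_square power3_eq_cube)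
  moreover have "8 * ?m * ?n ^ 2 \<le> ?n * ?n ^ 2"
    using sum_card_associating(2)[OF assms] by (intro mult_right_mono) simp_all
  ultimately show ?thesis
    by (simp add: algebra_simps power2_eq_square power3_eq_cube)
qed

end

theorem theorem2p4:
  fixes G (structure)
  assumes "moufang_loop G"
    and "finite (carrier G)"
    and "\<exists>x\<in>carrier G. \<exists>y\<in>carrier G. \<exists>z\<in>carrier G. (x \<otimes> y) \<otimes> z \<noteq> x \<otimes> (y \<otimes> z)"
    and "\<forall>a\<in>carrier G. \<forall>b\<in>carrier G. \<forall>c\<in>carrier G. \<forall>d\<in>carrier G.
           associator G a b (commutator G c d) = \<one>"
  shows "real (card {(x, y, z). x \<in> carrier G \<and> y \<in> carrier G \<and> z \<in> carrier G \<and>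
                       (x \<otimes> y) \<otimes> z = x \<otimes> (y \<otimes> z)})
         / real (card (carrier G)) ^ 3 \<le> 43 / 64"
proof -
  interpret nuclear_commutator_moufang_loop G
    using assms by (intro nuclear_commutator_moufang_loop.intro
        nuclear_commutator_moufang_loop_axioms.intro) auto
  obtain x where x: "x \<in> carrier G" "x \<notin> nucleus"
    using assms(3) by (auto simp: nucleus_def associate_def)
  \<comment> \<open>As a nested dependent sum, the set of triples has the cardinality estimated
    above.\<close>
  have triples: "{(x, y, z). x \<in> carrier G \<and> y \<in> carrier G \<and> z \<in> carrier G \<and>
        (x \<otimes> y) \<otimes> z = x \<otimes> (y \<otimes> z)}
      = (SIGMA x:carrier G. SIGMA y:carrier G. associating x y)"
    by (auto simp: associating_def associate_def)
  have "card (carrier G) > 0"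
    using x finite_carrier card_gt_0_iff by blast
  then show ?thesis
    using card_associating_triples[OF x] unfolding triples by (simp add: field_simps)
qed

end
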